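(* Let $n=\ell+g$ with integers $\ell\ge 1$, $g\ge 1$, let $\mu\in\mathbb{R}$, $\sigma>0$, $0\le\alpha<1$, put $\beta=\ell/(2n)$ and $\gamma=\alpha-(1-2\beta)$, and consider one step of the voting model described in the context with $\ell$ egoists and a group of $g$ members following Principle A. Let $\widetilde d^{A}_{\mathcal G}$ be the actual capital increment in this step of an arbitrary fixed group member. Then $$M(\widetilde d^{A}_{\mathcal G})=\mu\sum_{x=[\alpha n]+1}^{\ell}b(x\mid\ell)+\sum_{x=[g/2]+1}^{g}\left(\mu+\frac{\sigma f}{q}\left(\frac{x}{pg}-1\right)\right)b(x\mid g)\cdot\sum_{x=[\gamma n]+1}^{[\alpha n]}b(x\mid\ell).$$
   Context: Voting model (one step). There are $n$ participants: $\ell$ egoists and $g=n-\ell$ group members. An environment proposal is a random vector $(d_1,\dots,d_n)$ whose components are mutually independent with distribution $N(\mu,\sigma^2)$. Egoist $i$ votes "for" if and only if $d_i>0$. All $g$ group members vote identically: all "for" or none "for", according to the group's principle. Principle A: the group votes "for" iff the number of group members with $d_i>0$ exceeds the number of group members with $d_i<0$. The proposal is accepted iff more than $\alpha n$ participants vote "for". If it is accepted, the actual capital increment of participant $i$ is $\widetilde d_i=d_i$; otherwise it is $\widetilde d_i=0$. Notation: $M(\cdot)$ is expectation; $\varphi$ and $\Phi$ are the density and the cumulative distribution function of $N(0,1)$; $p=\Phi(\mu/\sigma)$, $q=1-p$, $f=\varphi(\mu/\sigma)$; $b(x\mid m)=\binom{m}{x}p^xq^{m-x}$, with $\binom{m}{x}=0$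 for $x<0$ or $x>m$; $[t]$ is the integer part (floor) of $t$; a sum whose lower limit exceeds its upper limit is zero. *)

theory Defs
  imports "HOL-Probability.Probability"
begin

text \<open>A realized proposal is a function \<open>c\<close> assigning to each participant the proposed capital
  increment; \<open>E\<close> and \<open>G\<close> are the sets of egoists and of group members.\<close>

definition principle_A :: "nat set \<Rightarrow> (nat \<Rightarrow> real) \<Rightarrow> bool" where
  "principle_A G c \<longleftrightarrow> card {i \<in> G. c i > 0} > card {i \<in> G. c i < 0}"

definition votes_for :: "nat set \<Rightarrow> ((nat \<Rightarrow> real) \<Rightarrow> bool) \<Rightarrow> (nat \<Rightarrow> real) \<Rightarrow> nat \<Rightarrow> bool" where
  "votes_for G principle c i \<longleftrightarrow> (if i \<in> G then principle c else c i > 0)"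

definition accepted ::
  "nat set \<Rightarrow> nat set \<Rightarrow> ((nat \<Rightarrow> real) \<Rightarrow> bool) \<Rightarrow> real \<Rightarrow> (nat \<Rightarrow> real) \<Rightarrow> bool" where
  "accepted E G principle \<alpha> c \<longleftrightarrow>
     real (card {i \<in> E \<union> G. votes_for G principle c i}) > \<alpha> * real (card (E \<union> G))"

definition actual_increment ::
  "nat set \<Rightarrow> nat set \<Rightarrow> ((nat \<Rightarrow> real) \<Rightarrow> bool) \<Rightarrow> real \<Rightarrow> (nat \<Rightarrow> real) \<Rightarrow> nat \<Rightarrow> real" where
  "actual_increment E G principle \<alpha> c i = (if accepted E G principle \<alpha> c then c i else 0)"

definition std_normal_cdf :: "real \<Rightarrow> real" where
  "std_normal_cdf = cdf (density lborel std_normal_density)"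

text \<open>The index \<open>x\<close> is an integer because the summation ranges below may start at negative
  numbers. For \<open>x > m\<close> the binomial coefficient is already zero.\<close>

definition binomial_term :: "real \<Rightarrow> nat \<Rightarrow> int \<Rightarrow> real" where
  "binomial_term p m x =
     (if x < 0 then 0
      else real (m choose nat x) * p ^ nat x * (1 - p) ^ (m - nat x))"

end

(* Almost surely no d_i vanishes, so the group votes "for" iff more than g/2 of its members have
   d_i > 0, and acceptance depends only on the numbers x of egoists and y of group members with
   d_i > 0: either x > alpha n, or alpha n - g < x <= alpha n and the group votes "for".  By
   independence, summing over all sign patterns gives the expectation as a double binomial sum
   over x and the number of other members with d_i > 0, where the fixed member k contributes
   E(d_k; d_k > 0) = mu p + sigma f or E(d_k; d_k <= 0) = mu q - sigma f.  Given y, member k is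
   one of the y positive ones with probability y/g, which produces the factor
   mu + (sigma f / q) (y / (p g) - 1). *)

theory Submission
  imports Defs "HOL-Real_Asymp.Real_Asymp"
begin

section \<open>Half-line integrals of the normal density\<close>

text \<open>The density satisfies \<phi>'(y) = -y \<phi>(y), so \<open>- std_normal_density\<close>
  is an antiderivative of the integrand; it vanishes at minus infinity, and only the value at
  \<open>c\<close> remains.\<close>

lemma std_normal_first_moment_below:
  "(\<integral>y. indicator {..<c} y * (y * std_normal_density y) \<partial>lborel) = - std_normal_density c"
proof -
  have lim: "(std_normal_density \<longlongrightarrow> 0) at_bot"
    unfolding std_normal_density_def by real_asymp
  have deriv: "(std_normal_density has_real_derivative - (x * std_normal_density x)) (at x)" for x
    unfolding std_normal_density_def by (auto intro!: derivative_eq_intros simp: field_simps)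
  have int: "integrable lborel (\<lambda>y. y * std_normal_density y)"
    using integrable_std_normal_moment[of 1] by (simp add: mult.commute)
  have "(LBINT y=-\<infinity>..ereal c. y * std_normal_density y) = - std_normal_density c - 0"
  proof (rule interval_integral_FTC_integrable[where F = "\<lambda>y. - std_normal_density y"])
    show "((\<lambda>y. - std_normal_density y) has_vector_derivative x * std_normal_density x) (at x)" for x
      using DERIV_minus[OF deriv[of x]] by (simp add: has_real_derivative_iff_has_vector_derivative)
    show "isCont (\<lambda>y. y * std_normal_density y) x" for x
      unfolding std_normal_density_def by (intro continuous_intros) auto
    show "set_integrable lborel (einterval (- \<infinity>) (ereal c)) (\<lambda>y. y * std_normal_density y)"
      unfolding set_integrable_def using integrable_mult_indicator[OF _ int] by simp
    show "(((\<lambda>y. - std_normal_density y) \<circ> real_of_ereal) \<longlongrightarrow> 0) (at_right (- \<infinity>))"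
      using tendsto_minus[OF lim] by (simp add: ereal_tendsto_simps)
    have "isCont (\<lambda>y. - std_normal_density y) c"
      unfolding std_normal_density_def by (intro continuous_intros) auto
    then have "((\<lambda>y. - std_normal_density y) \<longlongrightarrow> - std_normal_density c) (at_left c)"
      unfolding isCont_def by (rule filterlim_mono[OF _ order_refl at_le]) simp
    then show "(((\<lambda>y. - std_normal_density y) \<circ> real_of_ereal) \<longlongrightarrow> - std_normal_density c) (at_left (ereal c))"
      by (simp add: ereal_tendsto_simps)
  qed auto
  moreover have "einterval (-\<infinity>) (ereal c) = {..<c}"
    by (auto simp: einterval_def)
  ultimately show ?thesis
    by (simp add: interval_lebesgue_integral_def set_lebesgue_integral_def)
qed

text \<open>The closed half-line of the cdf may be opened because a point is Lebesgue null; the open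
  one is what the event \<open>X \<omega> > 0\<close> turns into after substitution.\<close>

lemma std_normal_cdf_eq_integral:
  "std_normal_cdf c = (\<integral>y. indicator {..<c} y * std_normal_density y \<partial>lborel)"
proof -
  interpret N: prob_space "density lborel std_normal_density"
    by (rule prob_space_normal_density) simp
  have "std_normal_cdf c = (\<integral>y. indicator {..c} y \<partial>density lborel std_normal_density)"
    by (simp add: std_normal_cdf_def cdf_def)
  also have "\<dots> = (\<integral>y. std_normal_density y * indicator {..c} y \<partial>lborel)"
    by (subst integral_density) auto
  also have "\<dots> = (\<integral>y. indicator {..<c} y * std_normal_density y \<partial>lborel)"
    by (rule integral_cong_AE)
       (use AE_lborel_singleton[of c] in \<open>auto elim!: eventually_mono split: split_indicator\<close>)
  finally show ?thesis .
qed

text \<open>The density is positive everywhere, so a set of Gaussian measure 0 would have Lebesgue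
  measure 0, which is impossible for a set containing a nondegenerate interval.\<close>

lemma std_normal_measure_pos:
  assumes "a < b" "{a..b} \<subseteq> S" "S \<in> sets borel"
  shows "measure (density lborel std_normal_density) S > 0"
proof -
  interpret N: prob_space "density lborel std_normal_density"
    by (rule prob_space_normal_density) simp
  have "N.prob S \<noteq> 0"
  proof
    assume "N.prob S = 0"
    then have "emeasure (density lborel std_normal_density) S = 0"
      by (simp add: N.emeasure_eq_measure)
    then have "(\<integral>\<^sup>+x. ennreal (std_normal_density x) * indicator S x \<partial>lborel) = 0"
      using assms(3) by (simp add: emeasure_density)
    then have "AE x in lborel. ennreal (std_normal_density x) * indicator S x = 0"
      using assms(3) by (subst (asm) nn_integral_0_iff_AE) auto
    then have "AE x in lborel. x \<notin> S"
      by (rule eventually_mono)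
         (use normal_density_pos[of 1 0] in \<open>auto simp: ennreal_eq_0_iff not_less[symmetric] split: split_indicator_asm\<close>)
    then have "AE x in lborel. x \<notin> {a..b}"
      by (rule eventually_mono) (use assms(2) in auto)
    then have "emeasure lborel {a..b} = 0"
      by (subst (asm) AE_iff_measurable[of "{a..b}"]) auto
    then show False using assms(1) by simp
  qed
  then show ?thesis
    by (simp add: zero_less_measure_iff)
qed

text \<open>Both \<open>{..c}\<close> and its complement contain an interval. The strict bounds
  later permit division by \<open>p\<close> and by \<open>1 - p\<close>.\<close>

lemma std_normal_cdf_bounds: "0 < std_normal_cdf c" "std_normal_cdf c < 1"
proof -
  interpret N: prob_space "density lborel std_normal_density"
    by (rule prob_space_normal_density) simp
  show "0 < std_normal_cdf c"
    using std_normal_measure_pos[of "c - 1" c "{..c}"] by (simp add: std_normal_cdf_def cdf_def)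
  have "N.prob {c<..} = 1 - N.prob {..c}"
    by (subst N.prob_compl[symmetric]) (auto intro!: arg_cong[where f = N.prob])
  then show "std_normal_cdf c < 1"
    using std_normal_measure_pos[of "c + 1" "c + 2" "{c<..}"]
    by (auto simp: std_normal_cdf_def cdf_def subset_eq)
qed

text \<open>The reflecting substitution x = \<mu> - \<sigma> y maps x > 0 to y < \<mu> / \<sigma>,
  so \<Phi>(\<mu> / \<sigma>) appears directly; the symmetry of the density absorbs the sign. The
  minus sign of the half-line first moment turns into the summand plus \<sigma> f.\<close>

lemma (in prob_space) normal_positive_part:
  assumes \<sigma>: "\<sigma> > 0" and D: "distributed M lborel X (normal_density \<mu> \<sigma>)"
  shows "expectation (\<lambda>\<omega>. of_bool (X \<omega> > 0)) = std_normal_cdf (\<mu> / \<sigma>)"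
    and "expectation (\<lambda>\<omega>. X \<omega> * of_bool (X \<omega> > 0)) =
           \<mu> * std_normal_cdf (\<mu> / \<sigma>) + \<sigma> * std_normal_density (\<mu> / \<sigma>)"
proof -
  have dens: "\<sigma> * normal_density \<mu> \<sigma> (\<mu> + (- \<sigma>) * y) = std_normal_density y" for y
    using \<sigma> by (simp add: normal_density_def real_sqrt_mult power_mult_distrib)
  have pos: "\<mu> + (- \<sigma>) * y > 0 \<longleftrightarrow> y < \<mu> / \<sigma>" for y
    using \<sigma> by (simp add: field_simps)
  \<comment> \<open>A general \<open>h\<close> serves both claims: the constant 1 gives the
    probability, the identity gives the truncated mean.\<close>
  have subst: "expectation (\<lambda>\<omega>. h (X \<omega>) * of_bool (X \<omega> > 0)) =
      (\<integral>y. h (\<mu> + (- \<sigma>) * y) * (indicator {..<\<mu> / \<sigma>} y * std_normal_density y) \<partial>lborel)"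
    if h[measurable]: "h \<in> borel_measurable borel" for h :: "real \<Rightarrow> real"
  proof -
    have "expectation (\<lambda>\<omega>. h (X \<omega>) * of_bool (X \<omega> > 0)) =
        (\<integral>x. normal_density \<mu> \<sigma> x * (h x * of_bool (x > 0)) \<partial>lborel)"
      by (rule distributed_integral[OF D, symmetric]) auto
    also have "\<dots> = \<sigma> * (\<integral>y. normal_density \<mu> \<sigma> (\<mu> + (- \<sigma>) * y) *
        (h (\<mu> + (- \<sigma>) * y) * of_bool (\<mu> + (- \<sigma>) * y > 0)) \<partial>lborel)"
      using \<sigma> by (subst lborel_integral_real_affine[where c = "- \<sigma>" and t = \<mu>]) auto
    also have "\<dots> = (\<integral>y. h (\<mu> + (- \<sigma>) * y) * (indicator {..<\<mu> / \<sigma>} y * std_normal_density y) \<partial>lborel)"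
      unfolding integral_mult_right_zero[symmetric]
      by (rule Bochner_Integration.integral_cong[OF refl])
         (use pos in \<open>auto simp: dens[symmetric] split: split_indicator\<close>)
    finally show ?thesis .
  qed
  show "expectation (\<lambda>\<omega>. of_bool (X \<omega> > 0)) = std_normal_cdf (\<mu> / \<sigma>)"
    using subst[of "\<lambda>_. 1"] by (simp add: std_normal_cdf_eq_integral)
  have int: "integrable lborel (\<lambda>y. indicator {..<\<mu> / \<sigma>} y * std_normal_density y)"
    "integrable lborel (\<lambda>y. indicator {..<\<mu> / \<sigma>} y * (y * std_normal_density y))"
    using integrable_mult_indicator[OF _ integrable_std_normal_moment[of 0], of "{..<\<mu> / \<sigma>}"]
      integrable_mult_indicator[OF _ integrable_std_normal_moment[of 1], of "{..<\<mu> / \<sigma>}"]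
    by (simp_all add: mult.commute)
  have "expectation (\<lambda>\<omega>. X \<omega> * of_bool (X \<omega> > 0)) =
      (\<integral>y. \<mu> * (indicator {..<\<mu> / \<sigma>} y * std_normal_density y) -
        \<sigma> * (indicator {..<\<mu> / \<sigma>} y * (y * std_normal_density y)) \<partial>lborel)"
    using subst[of "\<lambda>x. x"] by (simp add: algebra_simps)
  also have "\<dots> = \<mu> * std_normal_cdf (\<mu> / \<sigma>) + \<sigma> * std_normal_density (\<mu> / \<sigma>)"
    using int by (simp add: std_normal_cdf_eq_integral std_normal_first_moment_below)
  finally show "expectation (\<lambda>\<omega>. X \<omega> * of_bool (X \<omega> > 0)) =
           \<mu> * std_normal_cdf (\<mu> / \<sigma>) + \<sigma> * std_normal_density (\<mu> / \<sigma>)" .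
qed

section \<open>Sums over subsets and expectations over sign patterns\<close>

lemma sum_Pow_card:
  fixes h :: "nat \<Rightarrow> real"
  assumes "finite A"
  shows "(\<Sum>S\<in>Pow A. h (card S)) = (\<Sum>j\<le>card A. real (card A choose j) * h j)"
proof -
  have "(\<Sum>S\<in>Pow A. h (card S)) = (\<Sum>j\<le>card A. \<Sum>S\<in>{S \<in> Pow A. card S = j}. h (card S))"
    using assms by (intro sum.group[symmetric]) (auto intro: card_mono)
  also have "\<dots> = (\<Sum>j\<le>card A. real (card A choose j) * h j)"
    using n_subsets[OF assms] by (intro sum.cong) (auto simp: Pow_def)
  finally show ?thesis .
qed

lemma sum_Pow_Un_disjoint:
  assumes "A \<inter> B = {}"
  shows "(\<Sum>S\<in>Pow (A \<union> B). h S) = (\<Sum>T\<in>Pow A. \<Sum>U\<in>Pow B. h (T \<union> U))"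
proof -
  have "(\<Sum>S\<in>Pow (A \<union> B). h S) = (\<Sum>(T, U)\<in>Pow A \<times> Pow B. h (T \<union> U))"
    by (rule sum.reindex_bij_witness[where i = "\<lambda>(T, U). T \<union> U" and j = "\<lambda>S. (S \<inter> A, S \<inter> B)"])
       (use assms in \<open>auto simp: Int_Un_distrib[symmetric] Int_absorb2\<close>)
  then show ?thesis by (simp add: sum.cartesian_product)
qed

lemma prod_of_bool:
  "finite I \<Longrightarrow> (\<Prod>i\<in>I. of_bool (P i)) = (of_bool (\<forall>i\<in>I. P i) :: real)"
  by (induction I rule: finite_induct) auto

text \<open>The indicator that the set of positive coordinates equals \<open>S\<close> is a product
  over the coordinates. Multiplying factor \<open>k\<close> by the value of \<open>d k\<close> keeps
  this product form, so independence applies to each \<open>S\<close> separately. Zero counts as not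
  positive, hence no null set is discarded here.\<close>

lemma (in prob_space) expectation_sign_pattern:
  fixes d :: "'i \<Rightarrow> 'a \<Rightarrow> real" and F :: "'i set \<Rightarrow> real"
  assumes I: "finite I" "k \<in> I" and indep: "indep_vars (\<lambda>_. borel) d I"
    and int: "integrable M (d k)"
  defines "w \<equiv> \<lambda>S i x. (if i = k then x else 1) * of_bool (x > 0 \<longleftrightarrow> i \<in> S)"
  shows "integrable M (\<lambda>\<omega>. F {i \<in> I. d i \<omega> > 0} * d k \<omega>)"
    and "expectation (\<lambda>\<omega>. F {i \<in> I. d i \<omega> > 0} * d k \<omega>) =
      (\<Sum>S\<in>Pow I. F S * (\<Prod>i\<in>I. expectation (\<lambda>\<omega>. w S i (d i \<omega>))))"
proof -
  \<comment> \<open>Pointwise, exactly one of the products survives: the one whose \<open>S\<close>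
    is the actual set of positive coordinates.\<close>
  have eq: "F {i \<in> I. d i \<omega> > 0} * d k \<omega> = (\<Sum>S\<in>Pow I. F S * (\<Prod>i\<in>I. w S i (d i \<omega>)))" for \<omega>
  proof -
    have "(\<Prod>i\<in>I. w S i (d i \<omega>)) = d k \<omega> * of_bool (S = {i \<in> I. d i \<omega> > 0})"
      if "S \<in> Pow I" for S
    proof -
      have "(\<Prod>i\<in>I. w S i (d i \<omega>)) = d k \<omega> * of_bool (\<forall>i\<in>I. d i \<omega> > 0 \<longleftrightarrow> i \<in> S)"
        using I by (simp add: w_def prod.distrib prod_of_bool)
      then show ?thesis using that by (auto intro!: arg_cong[where f = of_bool])
    qed
    then have "(\<Sum>S\<in>Pow I. F S * (\<Prod>i\<in>I. w S i (d i \<omega>))) =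
        (\<Sum>S\<in>Pow I. if S = {i \<in> I. d i \<omega> > 0} then F S * d k \<omega> else 0)"
      by (intro sum.cong) auto
    also have "\<dots> = F {i \<in> I. d i \<omega> > 0} * d k \<omega>"
      using I by (subst sum.delta) auto
    finally show ?thesis by simp
  qed
  have rv: "d i \<in> borel_measurable M" if "i \<in> I" for i
    using indep that by (auto simp: indep_vars_def)
  have indep_w: "indep_vars (\<lambda>_. borel) (\<lambda>i \<omega>. w S i (d i \<omega>)) I" for S
    by (rule indep_vars_compose2[OF indep]) (auto simp: w_def)
  have int_w: "integrable M (\<lambda>\<omega>. w S i (d i \<omega>))" if "i \<in> I" for S i
  \<comment> \<open>Each factor is an indicator, dominated by 1, except factor \<open>k\<close>,
    which is dominated by \<open>d k\<close>.\<close>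
  proof (rule Bochner_Integration.integrable_bound[where f = "if i = k then d k else (\<lambda>_. 1)"])
    show "(\<lambda>\<omega>. w S i (d i \<omega>)) \<in> borel_measurable M"
      using rv[OF that] unfolding w_def by measurable
  qed (use int in \<open>auto simp: w_def\<close>)
  show "integrable M (\<lambda>\<omega>. F {i \<in> I. d i \<omega> > 0} * d k \<omega>)"
    unfolding eq
    by (intro Bochner_Integration.integrable_sum Bochner_Integration.integrable_mult_right
        indep_vars_integrable[OF I(1) indep_w] int_w)
  show "expectation (\<lambda>\<omega>. F {i \<in> I. d i \<omega> > 0} * d k \<omega>) =
      (\<Sum>S\<in>Pow I. F S * (\<Prod>i\<in>I. expectation (\<lambda>\<omega>. w S i (d i \<omega>))))"
    unfolding eq
    by (subst Bochner_Integration.integral_sum)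
       (auto intro!: Bochner_Integration.integrable_mult_right indep_vars_integrable[OF I(1) indep_w]
         int_w sum.cong simp: indep_vars_lebesgue_integral[OF I(1) indep_w int_w])
qed

text \<open>Every coordinate other than \<open>k\<close> contributes \<open>p\<close> or
  \<open>1 - p\<close>; coordinate \<open>k\<close> contributes its mean restricted to its sign,
  \<open>a\<close> or \<open>\<mu> - a\<close>. Patterns that differ only at \<open>k\<close> are
  paired, which leaves a sum over the signs \<open>V\<close> of the others.\<close>

lemma (in prob_space) expectation_iid_sign_pattern:
  fixes d :: "'i \<Rightarrow> 'a \<Rightarrow> real" and F :: "'i set \<Rightarrow> real"
  assumes I: "finite I" "k \<in> I" and indep: "indep_vars (\<lambda>_. borel) d I"
    and int: "integrable M (d k)"
    and p: "\<And>i. i \<in> I \<Longrightarrow> expectation (\<lambda>\<omega>. of_bool (d i \<omega> > 0)) = p"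
    and a: "expectation (\<lambda>\<omega>. d k \<omega> * of_bool (d k \<omega> > 0)) = a"
    and mean: "expectation (d k) = \<mu>"
  shows "expectation (\<lambda>\<omega>. F {i \<in> I. d i \<omega> > 0} * d k \<omega>) =
      (\<Sum>V\<in>Pow (I - {k}). p ^ card V * (1 - p) ^ card (I - {k} - V) *
        (a * F (insert k V) + (\<mu> - a) * F V))"
proof -
  define w where "w = (\<lambda>S i x. (if i = k then x else 1 :: real) * of_bool (x > 0 \<longleftrightarrow> i \<in> S))"
  have rv[measurable]: "d i \<in> borel_measurable M" if "i \<in> I" for i
    using indep that by (auto simp: indep_vars_def)
  have ex_other: "expectation (\<lambda>\<omega>. w S i (d i \<omega>)) = (if i \<in> S then p else 1 - p)"
    if i: "i \<in> I" "i \<noteq> k" for S i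
  proof -
    have "integrable M (\<lambda>\<omega>. of_bool (d i \<omega> > 0) :: real)"
      using rv[OF i(1)] by (intro integrable_const_bound[where B = 1]) auto
    then have "expectation (\<lambda>\<omega>. 1 - of_bool (d i \<omega> > 0)) = 1 - p"
      using p[OF i(1)] by (simp add: prob_space)
    then show ?thesis
      using i p[OF i(1)] by (simp add: w_def of_bool_not_iff)
  qed
  have ex_k: "expectation (\<lambda>\<omega>. w S k (d k \<omega>)) = (if k \<in> S then a else \<mu> - a)" for S
  proof -
    have "integrable M (\<lambda>\<omega>. d k \<omega> * of_bool (d k \<omega> > 0))"
      using rv[OF I(2)] by (intro Bochner_Integration.integrable_bound[OF int]) auto
    then have "expectation (\<lambda>\<omega>. d k \<omega> - d k \<omega> * of_bool (d k \<omega> > 0)) = \<mu> - a"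
      using a mean int by simp
    then show ?thesis
      using a by (simp add: w_def of_bool_not_iff algebra_simps)
  qed
  have prod_w: "(\<Prod>i\<in>I. expectation (\<lambda>\<omega>. w S i (d i \<omega>))) =
      (if k \<in> S then a else \<mu> - a) * (p ^ card (S - {k}) * (1 - p) ^ card (I - {k} - S))"
    if "S \<subseteq> I" for S
  proof -
    have "(\<Prod>i\<in>I - {k}. expectation (\<lambda>\<omega>. w S i (d i \<omega>))) =
        (\<Prod>i\<in>I - {k}. if i \<in> S then p else 1 - p)"
      by (rule prod.cong) (auto simp: ex_other)
    also have "\<dots> = p ^ card ((I - {k}) \<inter> S) * (1 - p) ^ card ((I - {k}) \<inter> - S)"
      using I by (subst prod.If_cases) auto
    also have "(I - {k}) \<inter> S = S - {k}" using that by auto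
    also have "(I - {k}) \<inter> - S = I - {k} - S" by auto
    finally show ?thesis
      using I by (simp add: prod.remove[of I k] ex_k)
  qed
  have "expectation (\<lambda>\<omega>. F {i \<in> I. d i \<omega> > 0} * d k \<omega>) =
      (\<Sum>S\<in>Pow I. F S * (\<Prod>i\<in>I. expectation (\<lambda>\<omega>. w S i (d i \<omega>))))"
    unfolding w_def by (rule expectation_sign_pattern[OF I indep int])
  \<comment> \<open>Splitting off \<open>{k}\<close> realises the pairing of \<open>V\<close> with
    \<open>insert k V\<close>.\<close>
  also have "Pow I = Pow ((I - {k}) \<union> {k})" using I by (simp add: insert_absorb)
  also have "(\<Sum>S\<in>\<dots>. F S * (\<Prod>i\<in>I. expectation (\<lambda>\<omega>. w S i (d i \<omega>)))) =
      (\<Sum>V\<in>Pow (I - {k}). \<Sum>K\<in>Pow {k}. F (V \<union> K) *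
        (\<Prod>i\<in>I. expectation (\<lambda>\<omega>. w (V \<union> K) i (d i \<omega>))))"
    by (rule sum_Pow_Un_disjoint) auto
  also have "\<dots> = (\<Sum>V\<in>Pow (I - {k}). p ^ card V * (1 - p) ^ card (I - {k} - V) *
        (a * F (insert k V) + (\<mu> - a) * F V))"
  proof (rule sum.cong[OF refl])
    fix V assume V: "V \<in> Pow (I - {k})"
    then have *: "k \<notin> V" "V \<subseteq> I" "insert k V \<subseteq> I" "V - {k} = V" using I by auto
    have "I - {k} - insert k V = I - {k} - V" by auto
    with * show "(\<Sum>K\<in>Pow {k}. F (V \<union> K) * (\<Prod>i\<in>I. expectation (\<lambda>\<omega>. w (V \<union> K) i (d i \<omega>)))) =
        p ^ card V * (1 - p) ^ card (I - {k} - V) * (a * F (insert k V) + (\<mu> - a) * F V)"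
      by (simp add: Pow_insert prod_w algebra_simps)
  qed
  finally show ?thesis .
qed

text \<open>A function of the two counts is a function of the positive set, so the pattern sum
  applies. It runs over subsets of \<open>E\<close> and of \<open>G - {k}\<close> independently, and
  grouping these by size produces the binomial coefficients. The group coefficient is taken from
  \<open>m\<close>, one less than the group size, because the sign of \<open>k\<close> is accounted
  for by \<open>a\<close> and \<open>\<mu> - a\<close>.\<close>

lemma (in prob_space) expectation_iid_two_counts:
  fixes d :: "'i \<Rightarrow> 'a \<Rightarrow> real" and h :: "nat \<Rightarrow> nat \<Rightarrow> real"
  assumes fin: "finite E" "finite G" and disj: "E \<inter> G = {}" and k: "k \<in> G"
    and indep: "indep_vars (\<lambda>_. borel) d (E \<union> G)"
    and int: "integrable M (d k)"
    and p: "\<And>i. i \<in> E \<union> G \<Longrightarrow> expectation (\<lambda>\<omega>. of_bool (d i \<omega> > 0)) = p"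
    and a: "expectation (\<lambda>\<omega>. d k \<omega> * of_bool (d k \<omega> > 0)) = a"
    and mean: "expectation (d k) = \<mu>"
    and l: "card E = l" and m: "card G = Suc m"
  shows "expectation (\<lambda>\<omega>. h (card {i \<in> E. d i \<omega> > 0}) (card {i \<in> G. d i \<omega> > 0}) * d k \<omega>) =
      (\<Sum>x\<le>l. real (l choose x) * p ^ x * (1 - p) ^ (l - x) *
        (\<Sum>y\<le>m. real (m choose y) * p ^ y * (1 - p) ^ (m - y) * (a * h x (Suc y) + (\<mu> - a) * h x y)))"
proof -
  let ?G = "G - {k}"
  define F where "F = (\<lambda>S. h (card (S \<inter> E)) (card (S \<inter> G)))"
  have m': "card ?G = m" using m k fin by simp
  have I: "finite (E \<union> G)" "k \<in> E \<union> G" using fin k by auto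
  have E: "E \<union> G - {k} = E \<union> ?G" using disj k by auto
  have "expectation (\<lambda>\<omega>. h (card {i \<in> E. d i \<omega> > 0}) (card {i \<in> G. d i \<omega> > 0}) * d k \<omega>) =
      expectation (\<lambda>\<omega>. F {i \<in> E \<union> G. d i \<omega> > 0} * d k \<omega>)"
    unfolding F_def
    by (intro Bochner_Integration.integral_cong refl arg_cong2[where f = "(*)"]
        arg_cong2[where f = h] arg_cong[where f = card]) auto
  also have "\<dots> = (\<Sum>V\<in>Pow (E \<union> ?G). p ^ card V * (1 - p) ^ card (E \<union> ?G - V) *
        (a * F (insert k V) + (\<mu> - a) * F V))"
    using expectation_iid_sign_pattern[OF I indep int p a mean, of F] unfolding E by simp
  also have "\<dots> = (\<Sum>T\<in>Pow E. \<Sum>U\<in>Pow ?G. p ^ card (T \<union> U) * (1 - p) ^ card (E \<union> ?G - (T \<union> U)) *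
        (a * F (insert k (T \<union> U)) + (\<mu> - a) * F (T \<union> U)))"
    by (rule sum_Pow_Un_disjoint) (use disj in auto)
  also have "\<dots> = (\<Sum>T\<in>Pow E. p ^ card T * (1 - p) ^ (l - card T) *
       (\<Sum>U\<in>Pow ?G. p ^ card U * (1 - p) ^ (m - card U) *
         (a * h (card T) (Suc (card U)) + (\<mu> - a) * h (card T) (card U))))"
    unfolding sum_distrib_left
  proof (intro sum.cong refl)
    fix T U assume T: "T \<in> Pow E" and U: "U \<in> Pow ?G"
    have fTU: "finite T" "finite U" using T U fin by (auto intro: finite_subset)
    have "card (T \<union> U) = card T + card U"
      using T U disj fTU by (intro card_Un_disjoint) auto
    moreover have "E \<union> ?G - (T \<union> U) = (E - T) \<union> (?G - U)"
      using T U disj by auto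
    moreover have "card ((E - T) \<union> (?G - U)) = card (E - T) + card (?G - U)"
      using fin disj by (intro card_Un_disjoint) auto
    moreover have "card (E - T) = l - card T" "card (?G - U) = m - card U"
      using T U l m' fTU by (auto simp: card_Diff_subset)
    moreover have "F (T \<union> U) = h (card T) (card U)"
      unfolding F_def using T U disj
      by (intro arg_cong2[where f = h] arg_cong[where f = card]) auto
    \<comment> \<open>Member \<open>k\<close> lies in \<open>G\<close> only, so its positive sign
      raises the group count by one and leaves the egoist count alone.\<close>
    moreover have "insert k (T \<union> U) \<inter> E = T" "insert k (T \<union> U) \<inter> G = insert k U"
      using T U disj k by auto
    then have "F (insert k (T \<union> U)) = h (card T) (Suc (card U))"
      unfolding F_def using U fTU by (auto simp: card_insert_if)
    ultimately show "p ^ card (T \<union> U) * (1 - p) ^ card (E \<union> ?G - (T \<union> U)) *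
        (a * F (insert k (T \<union> U)) + (\<mu> - a) * F (T \<union> U)) =
        p ^ card T * (1 - p) ^ (l - card T) * (p ^ card U * (1 - p) ^ (m - card U) *
         (a * h (card T) (Suc (card U)) + (\<mu> - a) * h (card T) (card U)))"
      by (simp add: power_add algebra_simps)
  qed
  also have "\<dots> = (\<Sum>x\<le>l. real (l choose x) * p ^ x * (1 - p) ^ (l - x) *
        (\<Sum>y\<le>m. real (m choose y) * p ^ y * (1 - p) ^ (m - y) * (a * h x (Suc y) + (\<mu> - a) * h x y)))"
  proof -
    let ?t = "\<lambda>x y. p ^ y * (1 - p) ^ (m - y) * (a * h x (Suc y) + (\<mu> - a) * h x y)"
    have "(\<Sum>U\<in>Pow ?G. ?t x (card U)) = (\<Sum>y\<le>m. real (m choose y) * ?t x y)" for x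
      using sum_Pow_card[of ?G "?t x"] fin m' by simp
    then show ?thesis
      using sum_Pow_card[OF fin(1), of "\<lambda>x. p ^ x * (1 - p) ^ (l - x) *
          (\<Sum>y\<le>m. real (m choose y) * ?t x y)"] l
      by (simp add: mult.assoc)
  qed
  finally show ?thesis .
qed

section \<open>Binomial identities and integer summation ranges\<close>

text \<open>This returns from the count among the other members to the count \<open>x\<close> in the
  whole group, by the two absorption identities for binomial coefficients. The ratio of
  \<open>x\<close> to \<open>Suc m\<close> is the chance that a fixed member is among the
  \<open>x\<close> positive ones; dividing by \<open>p\<close> and \<open>1 - p\<close> turns the
  restricted means \<open>a\<close> and \<open>b\<close> into conditional means.\<close>

lemma sum_binomial_pair:
  fixes p a b :: real
  assumes "p \<noteq> 0" "p \<noteq> 1"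
  shows "(\<Sum>y\<le>m. real (m choose y) * p ^ y * (1 - p) ^ (m - y) * (a * \<phi> (Suc y) + b * \<phi> y)) =
    (\<Sum>x\<le>Suc m. real (Suc m choose x) * p ^ x * (1 - p) ^ (Suc m - x) *
      (a * real x / (p * real (Suc m)) + b * (1 - real x / real (Suc m)) / (1 - p)) * \<phi> x)"
proof -
  have "(\<Sum>y\<le>m. real (m choose y) * p ^ y * (1 - p) ^ (m - y) * (a * \<phi> (Suc y))) =
      (\<Sum>x\<le>Suc m. real (Suc m choose x) * p ^ x * (1 - p) ^ (Suc m - x) *
        (a * real x / (p * real (Suc m))) * \<phi> x)"
  proof -
    have "real (m choose y) * p ^ y * (1 - p) ^ (m - y) * (a * \<phi> (Suc y)) =
        real (Suc m choose Suc y) * p ^ Suc y * (1 - p) ^ (Suc m - Suc y) *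
          (a * real (Suc y) / (p * real (Suc m))) * \<phi> (Suc y)" for y
    proof -
      have "real (Suc y) * real (Suc m choose Suc y) = real (Suc m) * real (m choose y)"
        by (metis Suc_times_binomial of_nat_mult)
      then have "real (m choose y) = real (Suc m choose Suc y) * real (Suc y) / real (Suc m)"
        by (simp add: field_simps del: binomial_Suc_Suc of_nat_Suc)
      then show ?thesis
        using assms by (simp del: binomial_Suc_Suc of_nat_Suc)
    qed
    \<comment> \<open>The index shifts by one; the new term at \<open>x = 0\<close> vanishes through
      its factor \<open>real x\<close>.\<close>
    then show ?thesis
      by (subst sum.atMost_Suc_shift) (simp del: binomial_Suc_Suc of_nat_Suc power_Suc)
  qed
  moreover have "(\<Sum>y\<le>m. real (m choose y) * p ^ y * (1 - p) ^ (m - y) * (b * \<phi> y)) =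
      (\<Sum>x\<le>Suc m. real (Suc m choose x) * p ^ x * (1 - p) ^ (Suc m - x) *
        (b * (1 - real x / real (Suc m)) / (1 - p)) * \<phi> x)"
  \<comment> \<open>Here there is no shift; the extra top term \<open>x = Suc m\<close> vanishes
    since 1 - x / (m + 1) is then 0.\<close>
  proof (subst sum.atMost_Suc, simp del: of_nat_Suc, rule sum.cong[OF refl])
    fix y assume y: "y \<in> {..m}"
    have "(Suc m - y) * (Suc m choose y) = Suc m * (m choose y)"
      using binomial_absorb_comp[of "Suc m" y] by simp
    then have "(real (Suc m) - real y) * real (Suc m choose y) = real (Suc m) * real (m choose y)"
      using y by (metis atMost_iff le_SucI of_nat_diff of_nat_mult)
    then have "real (m choose y) = real (Suc m choose y) * (1 - real y / real (Suc m))"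
      by (simp add: field_simps del: of_nat_Suc)
    moreover have "(1 - p) ^ (Suc m - y) = (1 - p) * (1 - p) ^ (m - y)"
      using y by (simp add: Suc_diff_le)
    ultimately show "real (m choose y) * p ^ y * (1 - p) ^ (m - y) * (b * \<phi> y) =
        real (Suc m choose y) * p ^ y * (1 - p) ^ (Suc m - y) *
          (b * (1 - real y / real (Suc m))) * \<phi> y / (1 - p)"
      using assms by simp
  qed
  ultimately show ?thesis
    by (simp only: distrib_left distrib_right sum.distrib)
qed

text \<open>Range ends may be negative or exceed \<open>m\<close>, where the terms are zero. Moving
  the range into an indicator makes sums with floors as limits comparable with sums over all natural
  numbers up to \<open>m\<close>.\<close>

lemma sum_binomial_term_interval:
  "(\<Sum>x = i..j. h x * binomial_term p m x) =
    (\<Sum>x\<le>m. of_bool (i \<le> int x \<and> int x \<le> j) * (h (int x) * (real (m choose x) * p ^ x * (1 - p) ^ (m - x))))"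
proof -
  have "(\<Sum>x = i..j. h x * binomial_term p m x) =
      (\<Sum>x\<in>{i..j} \<inter> int ` {..m}. h x * binomial_term p m x)"
  proof (rule sum.mono_neutral_right)
    \<comment> \<open>Negative indices give zero by definition; beyond \<open>m\<close> the binomial
      coefficient is zero, so the truncated exponent \<open>m - nat x\<close> is harmless.\<close>
    have "binomial_term p m x = 0" if "x \<notin> int ` {..m}" for x
    proof (cases "x < 0")
      case False
      then have "m < nat x" using that by (metis atMost_iff image_eqI int_nat_eq not_less)
      then show ?thesis by (simp add: binomial_term_def)
    qed (simp add: binomial_term_def)
    then show "\<forall>x\<in>{i..j} - {i..j} \<inter> int ` {..m}. h x * binomial_term p m x = 0" by auto
  qed auto
  also have "{i..j} \<inter> int ` {..m} = int ` {x \<in> {..m}. i \<le> int x \<and> int x \<le> j}" by auto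
  also have "(\<Sum>x\<in>\<dots>. h x * binomial_term p m x) =
      (\<Sum>x | x \<in> {..m} \<and> i \<le> int x \<and> int x \<le> j. h (int x) * binomial_term p m (int x))"
    by (subst sum.reindex) auto
  also have "\<dots> = (\<Sum>x\<le>m. of_bool (i \<le> int x \<and> int x \<le> j) * (h (int x) * (real (m choose x) * p ^ x * (1 - p) ^ (m - x))))"
    by (subst sum.inter_filter, simp, intro sum.cong refl) (simp add: binomial_term_def)
  finally show ?thesis .
qed

section \<open>The voting rule in terms of two counts\<close>

text \<open>Without zeros in the group, its negative members are the complement of the positive
  ones, so Principle A is a strict majority. The group adds all of its votes or none; if the egoists
  alone pass the threshold, its decision is immaterial.\<close>

lemma accepted_principle_A_iff:
  assumes fin: "finite E" "finite G" and disj: "E \<inter> G = {}" and nz: "\<And>i. i \<in> G \<Longrightarrow> c i \<noteq> 0"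
  defines "X \<equiv> card {i \<in> E. c i > 0}" and "Y \<equiv> card {i \<in> G. c i > 0}"
  shows "accepted E G (principle_A G) \<alpha> c \<longleftrightarrow>
    real X > \<alpha> * real (card E + card G) \<or>
    2 * Y > card G \<and> real X + real (card G) > \<alpha> * real (card E + card G)"
proof -
  have "{i \<in> G. c i < 0} = G - {i \<in> G. c i > 0}"
    using nz by (auto simp: not_less) (metis less_eq_real_def)
  then have "card {i \<in> G. c i < 0} = card G - Y"
    using fin by (simp add: card_Diff_subset Y_def)
  moreover have "Y \<le> card G"
    unfolding Y_def using fin by (intro card_mono) auto
  ultimately have group: "principle_A G c \<longleftrightarrow> 2 * Y > card G"
    unfolding principle_A_def Y_def[symmetric] by auto
  have "{i \<in> E \<union> G. votes_for G (principle_A G) c i} =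
      {i \<in> E. c i > 0} \<union> (if principle_A G c then G else {})"
    using disj by (auto simp: votes_for_def)
  moreover have "card ({i \<in> E. c i > 0} \<union> (if principle_A G c then G else {})) =
      X + (if principle_A G c then card G else 0)"
    unfolding X_def using fin disj by (subst card_Un_disjoint) auto
  moreover have "card (E \<union> G) = card E + card G"
    using fin disj by (rule card_Un_disjoint)
  ultimately show ?thesis
    unfolding accepted_def using group by auto
qed

section \<open>The expected increment of a group member\<close>

theorem mainTheorem2:
  fixes M :: "'a measure"
    and d :: "nat \<Rightarrow> 'a \<Rightarrow> real"
    and E G :: "nat set"
    and l g n k :: nat
    and \<mu> \<sigma> \<alpha> \<beta> \<gamma> p q f :: real
  assumes "prob_space M"
    and "l \<ge> 1" and "g \<ge> 1" and "n = l + g"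
    and "E \<union> G = {1..n}" and "E \<inter> G = {}" and "card E = l" and "card G = g"
    and "\<sigma> > 0" and "0 \<le> \<alpha>" and "\<alpha> < 1"
    and "\<beta> = real l / (2 * real n)" and "\<gamma> = \<alpha> - (1 - 2 * \<beta>)"
    and "prob_space.indep_vars M (\<lambda>_. borel) d {1..n}"
    and "\<And>i. i \<in> {1..n} \<Longrightarrow> distributed M lborel (d i) (normal_density \<mu> \<sigma>)"
    and "p = std_normal_cdf (\<mu> / \<sigma>)" and "q = 1 - p" and "f = std_normal_density (\<mu> / \<sigma>)"
    and "k \<in> G"
  shows "integrable M (\<lambda>\<omega>. actual_increment E G (principle_A G) \<alpha> (\<lambda>i. d i \<omega>) k) \<and>
    prob_space.expectation M (\<lambda>\<omega>. actual_increment E G (principle_A G) \<alpha> (\<lambda>i. d i \<omega>) k) =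
      \<mu> * (\<Sum>x = \<lfloor>\<alpha> * real n\<rfloor> + 1..int l. binomial_term p l x)
      + (\<Sum>x = \<lfloor>real g / 2\<rfloor> + 1..int g.
           (\<mu> + \<sigma> * f / q * (real_of_int x / (p * real g) - 1)) * binomial_term p g x)
        * (\<Sum>x = \<lfloor>\<gamma> * real n\<rfloor> + 1..\<lfloor>\<alpha> * real n\<rfloor>. binomial_term p l x)"
proof -
  interpret prob_space M by fact
  note EG = \<open>E \<union> G = {1..n}\<close>
  have k: "k \<in> {1..n}" using \<open>k \<in> G\<close> EG by auto
  have fin: "finite E" "finite G" using EG by (metis finite_Un finite_atLeastAtMost)+
  have D: "distributed M lborel (d i) (normal_density \<mu> \<sigma>)" if "i \<in> {1..n}" for i
    using assms(15) that .
  obtain m where m: "g = Suc m" using \<open>g \<ge> 1\<close> by (cases g) auto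
  have p01: "0 < p" "p < 1" using std_normal_cdf_bounds \<open>p = _\<close> by auto
  define a where "a = \<mu> * p + \<sigma> * f"
  define B where "B = (\<lambda>m x. real (m choose x) * p ^ x * (1 - p) ^ (m - x))"
  \<comment> \<open>The acceptance event is split into disjoint cases, so that its indicator is a
    sum: egoists suffice, or the group is decisive. The bound
    \<open>real x \<le> \<alpha> * real n\<close> prevents double counting.\<close>
  define h :: "nat \<Rightarrow> nat \<Rightarrow> real" where
    "h = (\<lambda>x y. of_bool (real x > \<alpha> * real n) +
      of_bool (\<alpha> * real n - real g < real x \<and> real x \<le> \<alpha> * real n) * of_bool (2 * y > g))"
  let ?X = "\<lambda>\<omega>. card {i \<in> E. d i \<omega> > 0}" and ?Y = "\<lambda>\<omega>. card {i \<in> G. d i \<omega> > 0}"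
  let ?inc = "\<lambda>\<omega>. actual_increment E G (principle_A G) \<alpha> (\<lambda>i. d i \<omega>) k"
  have rv[measurable]: "d i \<in> borel_measurable M" if "i \<in> {1..n}" for i
    using distributed_measurable[OF D[OF that]] by simp
  have ints: "integrable M (d k)"
  proof (rule distributed_integrable_var[OF D[OF k]])
    \<comment> \<open>The integrand is the centred first moment plus \<mu> times the zeroth
      one.\<close>
    have "integrable lborel (\<lambda>x. normal_density \<mu> \<sigma> x * (x - \<mu>) ^ 1 + \<mu> * (normal_density \<mu> \<sigma> x * (x - \<mu>) ^ 0))"
      using \<open>\<sigma> > 0\<close>
      by (intro Bochner_Integration.integrable_add Bochner_Integration.integrable_mult_right
          integrable_normal_moment)
    then show "integrable lborel (\<lambda>x. normal_density \<mu> \<sigma> x * x)" by (simp add: algebra_simps)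
  qed simp
  have indep: "indep_vars (\<lambda>_. borel) d (E \<union> G)" using assms(14) EG by simp
  have pp: "expectation (\<lambda>\<omega>. of_bool (d i \<omega> > 0)) = p" if "i \<in> E \<union> G" for i
    using normal_positive_part(1)[OF \<open>\<sigma> > 0\<close> D] that EG \<open>p = _\<close> by simp
  have aa: "expectation (\<lambda>\<omega>. d k \<omega> * of_bool (d k \<omega> > 0)) = a"
    using normal_positive_part(2)[OF \<open>\<sigma> > 0\<close> D[OF k]] \<open>p = _\<close> \<open>f = _\<close> a_def by simp
  have mean: "expectation (d k) = \<mu>"
    by (rule normal_distributed_expectation[OF \<open>\<sigma> > 0\<close> D[OF k]])
  \<comment> \<open>A normal law has no atom at 0; this supplies the hypothesis of
    \<open>accepted_principle_A_iff\<close> almost surely.\<close>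
  have AE_nz: "AE \<omega> in M. \<forall>i\<in>{1..n}. d i \<omega> \<noteq> 0"
  proof (rule AE_finite_allI)
    fix i assume i: "i \<in> {1..n}"
    show "AE \<omega> in M. d i \<omega> \<noteq> 0"
      using distributed_AE2[OF D[OF i], of "\<lambda>x. x \<noteq> 0"] AE_lborel_singleton[of "0 :: real"]
      by (auto elim: eventually_mono)
  qed simp
  have AE_eq: "AE \<omega> in M. ?inc \<omega> = h (?X \<omega>) (?Y \<omega>) * d k \<omega>"
    using AE_nz
  proof (rule eventually_mono)
    fix \<omega> assume nz: "\<forall>i\<in>{1..n}. d i \<omega> \<noteq> 0"
    have "accepted E G (principle_A G) \<alpha> (\<lambda>i. d i \<omega>) \<longleftrightarrow>
        real (?X \<omega>) > \<alpha> * real n \<or> 2 * ?Y \<omega> > g \<and> real (?X \<omega>) + real g > \<alpha> * real n"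
      using accepted_principle_A_iff[OF fin \<open>E \<inter> G = {}\<close>, of "\<lambda>i. d i \<omega>" \<alpha>] nz EG
        \<open>card E = l\<close> \<open>card G = g\<close> \<open>n = l + g\<close> by auto
    then show "?inc \<omega> = h (?X \<omega>) (?Y \<omega>) * d k \<omega>"
      unfolding actual_increment_def h_def by auto
  qed
  have "{i \<in> E. d i \<omega> > 0} = {i \<in> E \<union> G. d i \<omega> > 0} \<inter> E" "{i \<in> G. d i \<omega> > 0} = {i \<in> E \<union> G. d i \<omega> > 0} \<inter> G" for \<omega>
    by auto
  then have int_h: "integrable M (\<lambda>\<omega>. h (?X \<omega>) (?Y \<omega>) * d k \<omega>)"
    using expectation_sign_pattern(1)[OF _ _ indep ints, of "\<lambda>S. h (card (S \<inter> E)) (card (S \<inter> G))"]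
      fin \<open>k \<in> G\<close> by simp
  \<comment> \<open>The increment equals the \<open>h\<close> expression only almost everywhere, so
    transferring expectation and integrability needs its own measurability. Counts are measurable as
    finite sums of indicators.\<close>
  have meas: "?inc \<in> borel_measurable M"
  proof -
    have card_meas[measurable]: "(\<lambda>\<omega>. real (card {i \<in> A. P i \<omega>})) \<in> borel_measurable M"
      if A: "A \<subseteq> {1..n}" and P[measurable]: "\<And>i. i \<in> A \<Longrightarrow> Measurable.pred M (P i)"
      for A :: "nat set" and P
    proof -
      have "real (card {i \<in> A. P i \<omega>}) = (\<Sum>i\<in>A. of_bool (P i \<omega>))" for \<omega>
        using finite_subset[OF A] by (simp add: of_bool_def sum.If_cases Int_def)
      then show ?thesis by simp
    qed
    have rvG[measurable]: "d i \<in> borel_measurable M" if "i \<in> G" for i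
      using that EG by (intro rv) auto
    have [measurable]: "Measurable.pred M (\<lambda>\<omega>. principle_A G (\<lambda>i. d i \<omega>))"
      unfolding principle_A_def of_nat_less_iff[symmetric, where 'a = real]
      by (intro borel_measurable_pred_less card_meas) (use EG rvG in auto)
    have "Measurable.pred M (\<lambda>\<omega>. votes_for G (principle_A G) (\<lambda>i. d i \<omega>) i)" if "i \<in> {1..n}" for i
      using rv[OF that] unfolding votes_for_def by measurable
    then have [measurable]: "Measurable.pred M (\<lambda>\<omega>. accepted E G (principle_A G) \<alpha> (\<lambda>i. d i \<omega>))"
      unfolding accepted_def EG
      by (intro borel_measurable_pred_less card_meas borel_measurable_const) auto
    show ?thesis
      using rv[OF k] unfolding actual_increment_def by measurable
  qed
  have "expectation ?inc = expectation (\<lambda>\<omega>. h (?X \<omega>) (?Y \<omega>) * d k \<omega>)"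
    by (rule integral_cong_AE[OF meas borel_measurable_integrable[OF int_h] AE_eq])
  also have "\<dots> = (\<Sum>x\<le>l. B l x * (\<Sum>y\<le>m. B m y * (a * h x (Suc y) + (\<mu> - a) * h x y)))"
    unfolding B_def
    using expectation_iid_two_counts[OF fin \<open>E \<inter> G = {}\<close> \<open>k \<in> G\<close> indep ints pp aa mean \<open>card E = l\<close>]
      \<open>card G = g\<close> m by simp
  \<comment> \<open>The first summand of \<open>h\<close> is independent of \<open>y\<close>: there
    \<open>a\<close> and \<open>\<mu> - a\<close> add up to \<mu> and the weights
    \<open>B m y\<close> sum to 1. In the second, the condition on \<open>x\<close> factors out of
    the sum over \<open>y\<close>.\<close>
  also have "\<dots> = (\<Sum>x\<le>l. B l x * (\<mu> * of_bool (real x > \<alpha> * real n) +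
      of_bool (\<alpha> * real n - real g < real x \<and> real x \<le> \<alpha> * real n) *
      (\<Sum>y\<le>m. B m y * (a * of_bool (2 * Suc y > g) + (\<mu> - a) * of_bool (2 * y > g)))))"
  proof (intro sum.cong refl arg_cong2[where f = "(*)"])
    fix x
    have B_sum: "(\<Sum>y\<le>m. B m y) = 1"
      using binomial_ring[of p "1 - p" m] by (simp add: B_def)
    let ?u = "of_bool (real x > \<alpha> * real n) :: real"
    let ?v = "of_bool (\<alpha> * real n - real g < real x \<and> real x \<le> \<alpha> * real n) :: real"
    have "(\<Sum>y\<le>m. B m y * (a * h x (Suc y) + (\<mu> - a) * h x y)) =
        (\<Sum>y\<le>m. \<mu> * ?u * B m y + ?v * (B m y * (a * of_bool (2 * Suc y > g) + (\<mu> - a) * of_bool (2 * y > g))))"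
      unfolding h_def by (intro sum.cong refl) (simp add: algebra_simps del: of_bool_eq of_bool_conj)
    also have "\<dots> = \<mu> * ?u + ?v * (\<Sum>y\<le>m. B m y * (a * of_bool (2 * Suc y > g) + (\<mu> - a) * of_bool (2 * y > g)))"
      by (simp only: sum.distrib sum_distrib_left[symmetric] B_sum mult_1_right)
    finally show "(\<Sum>y\<le>m. B m y * (a * h x (Suc y) + (\<mu> - a) * h x y)) =
        \<mu> * ?u + ?v * (\<Sum>y\<le>m. B m y * (a * of_bool (2 * Suc y > g) + (\<mu> - a) * of_bool (2 * y > g)))" .
  qed
  also have "(\<Sum>y\<le>m. B m y * (a * of_bool (2 * Suc y > g) + (\<mu> - a) * of_bool (2 * y > g))) =
      (\<Sum>x\<le>g. B g x * (a * real x / (p * real g) + (\<mu> - a) * (1 - real x / real g) / (1 - p)) * of_bool (2 * x > g))"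
    unfolding B_def m using p01 by (subst sum_binomial_pair) auto
  also have "\<dots> = (\<Sum>x\<le>g. of_bool (2 * x > g) * ((\<mu> + \<sigma> * f / q * (real x / (p * real g) - 1)) * B g x))"
  proof (rule sum.cong[OF refl])
    fix x
    \<comment> \<open>With a = \<mu> p + \<sigma> f and \<mu> - a = \<mu> q - \<sigma> f the \<mu>
      parts sum to \<mu>, and 1/p + 1/q = 1/(p q) collects the \<sigma> f parts.\<close>
    have "a * real x / (p * real g) + (\<mu> - a) * (1 - real x / real g) / (1 - p) =
        \<mu> + \<sigma> * f / q * (real x / (p * real g) - 1)"
      unfolding a_def \<open>q = 1 - p\<close> using p01 \<open>g \<ge> 1\<close> by (simp add: divide_simps) (simp add: algebra_simps)
    then show "B g x * (a * real x / (p * real g) + (\<mu> - a) * (1 - real x / real g) / (1 - p)) * of_bool (2 * x > g) =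
        of_bool (2 * x > g) * ((\<mu> + \<sigma> * f / q * (real x / (p * real g) - 1)) * B g x)"
      by simp
  qed
  also have "\<dots> = (\<Sum>x = \<lfloor>real g / 2\<rfloor> + 1..int g.
           (\<mu> + \<sigma> * f / q * (real_of_int x / (p * real g) - 1)) * binomial_term p g x)"
  proof -
    \<comment> \<open>The strict majority is the range starting just above the floor, for either
      parity of \<open>g\<close>.\<close>
    have "\<lfloor>real g / 2\<rfloor> + 1 \<le> int x \<longleftrightarrow> 2 * x > g" for x by linarith
    then show ?thesis
      unfolding sum_binomial_term_interval B_def by (intro sum.cong refl) auto
  qed
  \<comment> \<open>\<open>C\<close> stands for the group factor, which no longer depends on
    \<open>x\<close>.\<close>
  also have "(\<Sum>x\<le>l. B l x * (\<mu> * of_bool (real x > \<alpha> * real n) +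
      of_bool (\<alpha> * real n - real g < real x \<and> real x \<le> \<alpha> * real n) * C)) =
      \<mu> * (\<Sum>x = \<lfloor>\<alpha> * real n\<rfloor> + 1..int l. binomial_term p l x) +
      C * (\<Sum>x = \<lfloor>\<gamma> * real n\<rfloor> + 1..\<lfloor>\<alpha> * real n\<rfloor>. binomial_term p l x)" for C
  proof -
    \<comment> \<open>Since 2 \<beta> n = l, the product (1 - 2 \<beta>) n is g.\<close>
    have "\<gamma> * real n = \<alpha> * real n - real g"
      using \<open>\<gamma> = _\<close> \<open>\<beta> = _\<close> \<open>n = l + g\<close> \<open>l \<ge> 1\<close> by (simp add: field_simps)
    then have bounds: "\<lfloor>\<gamma> * real n\<rfloor> + 1 \<le> int x \<longleftrightarrow> \<alpha> * real n - real g < real x"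
      "int x \<le> \<lfloor>\<alpha> * real n\<rfloor> \<longleftrightarrow> real x \<le> \<alpha> * real n"
      "\<lfloor>\<alpha> * real n\<rfloor> + 1 \<le> int x \<longleftrightarrow> \<alpha> * real n < real x" for x
      by linarith+
    have interval: "(\<Sum>x = i..j. binomial_term p l x) = (\<Sum>x\<le>l. of_bool (i \<le> int x \<and> int x \<le> j) * B l x)" for i j
      using sum_binomial_term_interval[of "\<lambda>_. 1"] by (simp add: B_def)
    have "(\<Sum>x = \<lfloor>\<alpha> * real n\<rfloor> + 1..int l. binomial_term p l x) =
        (\<Sum>x\<le>l. of_bool (real x > \<alpha> * real n) * B l x)"
      unfolding interval bounds by (intro sum.cong refl) auto
    moreover have "(\<Sum>x = \<lfloor>\<gamma> * real n\<rfloor> + 1..\<lfloor>\<alpha> * real n\<rfloor>. binomial_term p l x) =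
        (\<Sum>x\<le>l. of_bool (\<alpha> * real n - real g < real x \<and> real x \<le> \<alpha> * real n) * B l x)"
      unfolding interval bounds ..
    ultimately show ?thesis
      by (simp only: sum_distrib_left sum.distrib[symmetric]) (intro sum.cong refl, simp only: distrib_left mult_ac)
  qed
  finally show ?thesis
    using integrable_cong_AE_imp[OF int_h meas] AE_eq by (simp add: eq_commute)
qed

end
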